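(* Let $f\in\mathbb{N}[q,t]$ be a polynomial that is symmetric in the two variables $q$ and $t$. Then $f$ is unimodal by degree if and only if all the coefficients of the expansion of $f$ in the basis of two-variable Schur polynomials $\{s_{ab}\}_{a\ge b\ge 0}$ are non-negative integers.
   Context: $\mathbb{N}=\{0,1,2,\ldots\}$. For integers $a\ge b\ge 0$, the two-variable Schur polynomial is $s_{ab}=q^at^b+q^{a-1}t^{b+1}+\cdots+q^{b+1}t^{a-1}+q^bt^a$; these form a basis of the ring of symmetric polynomials in $q,t$. A homogeneous polynomial $\sum_{i=0}^d c_i\,q^it^{d-i}$ of degree $d$ is unimodal if its coefficient sequence $(c_0,c_1,\ldots,c_d)$ is unimodal, i.e. $c_0\le\cdots\le c_k\ge\cdots\ge c_d$ for some $k$. A polynomial in $q,t$ is unimodal by degree if each of its homogeneous components (with respect to total degree in $q,t$) is unimodal. *)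

theory Defs
  imports Complex_Main "HOL-Computational_Algebra.Polynomial"
begin

text \<open>
  An element of \<open>R[q,t] = R[q][t]\<close> is a value of type \<open>R poly poly\<close>: the outer variable
  is \<open>t\<close>, the inner one is \<open>q\<close>.
\<close>

definition qvar :: "'a::comm_semiring_1 poly poly" where
  "qvar = [:[:0, 1:]:]"

definition tvar :: "'a::comm_semiring_1 poly poly" where
  "tvar = [:0, 1:]"

text \<open>\<open>coeff2 f i j\<close> is the coefficient of \<open>q\<^sup>i t\<^sup>j\<close> in \<open>f\<close>.\<close>

definition coeff2 :: "'a::zero poly poly \<Rightarrow> nat \<Rightarrow> nat \<Rightarrow> 'a" where
  "coeff2 f i j = coeff (coeff f j) i"

definition symmetric2 :: "'a::zero poly poly \<Rightarrow> bool" where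
  "symmetric2 f \<longleftrightarrow> (\<forall>i j. coeff2 f i j = coeff2 f j i)"

definition unimodal_seq :: "nat \<Rightarrow> (nat \<Rightarrow> 'a::linorder) \<Rightarrow> bool" where
  "unimodal_seq d c \<longleftrightarrow>
     (\<exists>k\<le>d. (\<forall>i<k. c i \<le> c (Suc i)) \<and> (\<forall>i. k \<le> i \<and> i < d \<longrightarrow> c (Suc i) \<le> c i))"

text \<open>
  The homogeneous component of \<open>f\<close> of total degree \<open>d\<close> is the sum over \<open>i \<le> d\<close> of
  \<open>coeff2 f i (d - i)\<close> times \<open>q\<^sup>i t\<^bsup>d-i\<^esup>\<close>.
\<close>

definition unimodal_by_degree :: "'a::{zero,linorder} poly poly \<Rightarrow> bool" where
  "unimodal_by_degree f \<longleftrightarrow> (\<forall>d. unimodal_seq d (\<lambda>i. coeff2 f i (d - i)))"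

text \<open>Only meaningful for \<open>b \<le> a\<close>, since subtraction on natural numbers is truncated.\<close>

definition schur2 :: "nat \<Rightarrow> nat \<Rightarrow> 'a::comm_semiring_1 poly poly" where
  "schur2 a b = (\<Sum>k=0..a-b. qvar ^ (a - k) * tvar ^ (b + k))"

definition schur2_basis :: "'a::comm_semiring_1 poly poly set" where
  "schur2_basis = {schur2 a b | a b. b \<le> a}"

definition scale2 :: "'a::comm_semiring_1 \<Rightarrow> 'a poly poly \<Rightarrow> 'a poly poly" where
  "scale2 c f = smult [:c:] f"

interpretation poly2: module "scale2 :: 'a::comm_ring_1 \<Rightarrow> 'a poly poly \<Rightarrow> 'a poly poly"
  by unfold_locales (auto simp: scale2_def smult_add_right smult_add_left[symmetric] pCons_one mult.commute)

text \<open>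
  \<open>poly2.representation B f v\<close> is the coefficient of \<open>v\<close> in the expansion of \<open>f\<close> in the
  basis \<open>B\<close>. It has a junk value unless \<open>B\<close> is independent and \<open>f\<close> lies in its span;
  for \<open>schur2_basis\<close> and symmetric \<open>f\<close> this is guaranteed by \<open>independent_schur2_basis\<close>
  and \<open>span_schur2_basis\<close> below, and \<open>schur2_inj\<close> shows that the coefficients
  are indexed by the pairs \<open>(a, b)\<close> with \<open>b \<le> a\<close>.
\<close>

definition schur_coeff :: "'a::comm_ring_1 poly poly \<Rightarrow> nat \<Rightarrow> nat \<Rightarrow> 'a" where
  "schur_coeff f a b = poly2.representation schur2_basis f (schur2 a b)"

text \<open>The inclusion of \<open>\<nat>[q,t]\<close> into \<open>R[q,t]\<close>.\<close>

definition of_nat_poly2 :: "nat poly poly \<Rightarrow> 'a::comm_semiring_1 poly poly" where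
  "of_nat_poly2 f = map_poly (map_poly of_nat) f"

lemma coeff2_of_nat_poly2: "coeff2 (of_nat_poly2 f) i j = of_nat (coeff2 f i j)"
  by (simp add: coeff2_def of_nat_poly2_def coeff_map_poly)

lemma coeff2_scale2: "coeff2 (scale2 c f) i j = c * coeff2 f i j"
  by (simp add: coeff2_def scale2_def)

lemma coeff2_sum: "coeff2 (sum f A) i j = (\<Sum>x\<in>A. coeff2 (f x) i j)"
  by (simp add: coeff2_def coeff_sum)

lemma coeff2_0: "coeff2 0 i j = 0"
  by (simp add: coeff2_def)

lemma poly2_eqI: "(\<And>i j. coeff2 f i j = coeff2 g i j) \<Longrightarrow> f = g"
  by (simp add: coeff2_def poly_eq_iff)

lemma qvar_tvar_power: "qvar ^ m * tvar ^ n = monom (monom (1::'a::comm_semiring_1) m) n"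
proof -
  have t: "tvar ^ n = monom (1::'a poly) n"
    by (simp add: tvar_def monom_altdef)
  have "(qvar ^ m :: 'a poly poly) = [:[:0,1:] ^ m:]"
    by (induction m) (simp_all add: qvar_def mult.commute)
  also have "\<dots> = [:monom 1 m:]"
    by (simp add: monom_altdef)
  finally show ?thesis
    by (simp add: t smult_monom)
qed

lemma coeff2_schur2:
  assumes "b \<le> a"
  shows "coeff2 (schur2 a b :: 'a::comm_semiring_1 poly poly) i j =
           (if i + j = a + b \<and> b \<le> i \<and> b \<le> j then 1 else 0)"
proof -
  have "coeff2 (schur2 a b :: 'a poly poly) i j =
          (\<Sum>k=0..a-b. if k = j - b then (if i + j = a + b \<and> b \<le> i \<and> b \<le> j then 1 else 0) else 0)"
    unfolding schur2_def coeff2_sum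
    by (rule sum.cong) (use assms in \<open>auto simp: qvar_tvar_power coeff2_def\<close>)
  also have "\<dots> = (if i + j = a + b \<and> b \<le> i \<and> b \<le> j then 1 else 0)"
    using assms by (subst sum.delta) auto
  finally show ?thesis .
qed

text \<open>
  A coefficient formula, used to prove that the two-variable Schur polynomials form a basis.
\<close>

definition hw_coeff :: "nat \<Rightarrow> nat \<Rightarrow> 'a::comm_ring_1 poly poly \<Rightarrow> 'a" where
  "hw_coeff a b f = coeff2 f a b - (if b = 0 then 0 else coeff2 f (Suc a) (b - 1))"

lemma hw_coeff_schur2:
  assumes "b \<le> a" "b' \<le> a'"
  shows "hw_coeff a b (schur2 a' b' :: 'a::comm_ring_1 poly poly) = (if a = a' \<and> b = b' then 1 else 0)"
  using assms by (auto simp: hw_coeff_def coeff2_schur2)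

lemma hw_coeff_sum_scale2:
  "hw_coeff a b (\<Sum>x\<in>A. scale2 (u x) (g x)) = (\<Sum>x\<in>A. u x * hw_coeff a b (g x))"
  by (auto simp: hw_coeff_def coeff2_sum coeff2_scale2 right_diff_distrib sum_subtractf)

lemma schur2_inj:
  assumes "b \<le> a" "b' \<le> a'" "(schur2 a b :: 'a::comm_ring_1 poly poly) = schur2 a' b'"
  shows "a = a' \<and> b = b'"
proof (rule ccontr)
  assume "\<not> ?thesis"
  with hw_coeff_schur2[OF assms(1,2), where 'a='a] hw_coeff_schur2[OF assms(1,1), where 'a='a] assms(3)
  show False by auto
qed

lemma independent_schur2_basis:
  "poly2.independent (schur2_basis :: 'a::comm_ring_1 poly poly set)"
  unfolding poly2.independent_explicit_module
proof (intro allI impI)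
  fix S :: "'a poly poly set" and u v
  assume S: "finite S" "S \<subseteq> schur2_basis" "(\<Sum>v\<in>S. scale2 (u v) v) = 0" and v: "v \<in> S"
  then obtain a b where ab: "b \<le> a" "v = schur2 a b"
    unfolding schur2_basis_def by blast
  have "0 = hw_coeff a b (\<Sum>v\<in>S. scale2 (u v) v)"
    by (simp add: S(3) hw_coeff_def coeff2_0)
  also have "\<dots> = (\<Sum>w\<in>S. u w * hw_coeff a b w)"
    by (rule hw_coeff_sum_scale2)
  also have "\<dots> = (\<Sum>w\<in>S. if w = v then u v else 0)"
  proof (rule sum.cong)
    fix w assume "w \<in> S"
    with S(2) obtain a' b' where w: "b' \<le> a'" "w = schur2 a' b'"
      unfolding schur2_basis_def by blast
    show "u w * hw_coeff a b w = (if w = v then u v else 0)"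
      using w ab schur2_inj[OF ab(1) w(1), where 'a='a] by (auto simp: hw_coeff_schur2)
  qed simp
  also have "\<dots> = u v"
    using S(1) v by simp
  finally show "u v = 0" by simp
qed

lemma hw_coeff_telescope:
  "j \<le> n \<Longrightarrow> (\<Sum>b\<le>j. hw_coeff (n - b) b f) = coeff2 f (n - j) j"
proof (induction j)
  case (Suc j)
  have "Suc (n - Suc j) = n - j" using Suc.prems by simp
  with Suc show ?case by (simp add: hw_coeff_def)
qed (simp add: hw_coeff_def)

lemma symmetric2_expansion:
  fixes f :: "'a::comm_ring_1 poly poly"
  assumes "symmetric2 f"
  shows "f = (\<Sum>d\<le>2 * degree f. \<Sum>b\<le>d div 2. scale2 (hw_coeff (d - b) b f) (schur2 (d - b) b))"
    (is "f = ?g")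
proof (rule poly2_eqI)
  fix i j :: nat
  define m where "m = min i j"
  have zero: "coeff2 f i j = 0" if "i + j > 2 * degree f"
  proof (cases "j > degree f")
    case False
    then have "coeff2 f j i = 0"
      using that by (simp add: coeff2_def coeff_eq_0)
    then show ?thesis using assms by (simp add: symmetric2_def)
  qed (simp add: coeff2_def coeff_eq_0)
  have "coeff2 ?g i j = (\<Sum>d\<le>2 * degree f. if d = i + j then
          (\<Sum>b\<le>(i + j) div 2. if b \<le> m then hw_coeff (i + j - b) b f else 0) else 0)"
    unfolding coeff2_sum coeff2_scale2
    by (intro sum.cong refl) (auto simp: coeff2_schur2 m_def intro!: sum.cong sum.neutral)
  also have "\<dots> = (if i + j \<le> 2 * degree f then
          (\<Sum>b\<le>(i + j) div 2. if b \<le> m then hw_coeff (i + j - b) b f else 0) else 0)"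
    by simp
  also have "(\<Sum>b\<le>(i + j) div 2. if b \<le> m then hw_coeff (i + j - b) b f else 0)
      = (\<Sum>b\<le>m. hw_coeff (i + j - b) b f)"
    by (rule sum.mono_neutral_cong_right) (auto simp: m_def)
  also have "\<dots> = coeff2 f (i + j - m) m"
    by (rule hw_coeff_telescope) (simp add: m_def)
  also have "\<dots> = coeff2 f i j"
    using assms by (auto simp: m_def min_def symmetric2_def)
  finally show "coeff2 f i j = coeff2 ?g i j"
    using zero by auto
qed

lemma span_schur2_basis:
  "poly2.span (schur2_basis :: 'a::comm_ring_1 poly poly set) = {f. symmetric2 f}"
proof (intro subset_antisym subsetI)
  fix f :: "'a poly poly" assume "f \<in> poly2.span schur2_basis"
  then show "f \<in> {f. symmetric2 f}"
  proof (induction rule: poly2.span_induct_alt)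
    case base
    show ?case by (simp add: symmetric2_def coeff2_0)
  next
    case (step c x y)
    then have "symmetric2 x"
      by (auto simp: schur2_basis_def symmetric2_def coeff2_schur2 add.commute)
    with step(2) show ?case
      by (simp add: symmetric2_def coeff2_def scale2_def)
  qed
next
  fix f :: "'a poly poly" assume "f \<in> {f. symmetric2 f}"
  then have "f = (\<Sum>d\<le>2 * degree f. \<Sum>b\<le>d div 2. scale2 (hw_coeff (d - b) b f) (schur2 (d - b) b))"
    by (intro symmetric2_expansion) simp
  moreover have "\<dots> \<in> poly2.span schur2_basis"
    by (intro poly2.span_sum poly2.span_scale poly2.span_base)
      (fastforce simp: schur2_basis_def)
  ultimately show "f \<in> poly2.span schur2_basis" by simp
qed

end

theory Submission
  imports Defs
begin

text \<open>
  The coefficient of \<open>schur2 a b\<close> in a symmetric polynomial \<open>F\<close> is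
  \<open>[q\<^sup>a t\<^sup>b] F - [q\<^bsup>a+1\<^esup> t\<^bsup>b-1\<^esup>] F\<close> (the second term being absent for \<open>b = 0\<close>): among
  the Schur polynomials the first monomial occurs in \<open>schur2 (a + k) (b - k)\<close> for
  \<open>0 \<le> k \<le> b\<close> and in no others, the second in the same ones except for
  \<open>k = 0\<close>. The difference thus isolates \<open>schur2 a b\<close> (\<open>schur_coeff_eq_hw_coeff\<close>).

  Hence the Schur coefficients in degree \<open>d\<close> are, apart from a single coefficient of \<open>F\<close>, the
  successive drops of the coefficient sequence of the degree \<open>d\<close> component, taken over the upper
  half of the sequence. They are all non-negative exactly when the sequence decreases
  on its upper half, and for a palindromic sequence this is the same as unimodality
  (\<open>unimodal_seq_palindrome_iff\<close>). Integrality is automatic, because the drops are differences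
  of natural numbers.
\<close>

lemma schur_coeff_eq_hw_coeff:
  fixes F :: "'a::comm_ring_1 poly poly"
  assumes "symmetric2 F" and "b \<le> a"
  shows "schur_coeff F a b = hw_coeff a b F"
proof -
  define r where "r = poly2.representation schur2_basis F"
  define S where "S = {v. r v \<noteq> 0}"
  define s :: "'a poly poly" where "s = schur2 a b"
  have fin: "finite S"
    unfolding S_def r_def by (rule poly2.finite_representation)
  have "F \<in> poly2.span schur2_basis"
    using assms(1) by (simp add: span_schur2_basis)
  then have "F = (\<Sum>v\<in>S. scale2 (r v) v)"
    unfolding S_def r_def
    by (rule poly2.sum_nonzero_representation_eq[OF independent_schur2_basis, symmetric])
  then have "hw_coeff a b F = hw_coeff a b (\<Sum>v\<in>S. scale2 (r v) v)"
    by simp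
  also have "\<dots> = (\<Sum>v\<in>S. r v * hw_coeff a b v)"
    by (rule hw_coeff_sum_scale2)
  \<comment> \<open>On the basis, \<open>hw_coeff a b\<close> is the coordinate functional dual to \<open>schur2 a b\<close>.\<close>
  also have "\<dots> = (\<Sum>v\<in>S. if v = s then r s else 0)"
  proof (rule sum.cong)
    fix v assume "v \<in> S"
    then have "v \<in> schur2_basis"
      unfolding S_def r_def using poly2.representation_ne_zero by blast
    then obtain a' b' where "b' \<le> a'" "v = schur2 a' b'"
      unfolding schur2_basis_def by blast
    then show "r v * hw_coeff a b v = (if v = s then r s else 0)"
      using assms(2) schur2_inj[of b a b' a', where 'a='a]
      by (auto simp: hw_coeff_schur2 s_def)
  qed simp
  also have "\<dots> = r s"
    using fin by (simp add: S_def)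
  finally show ?thesis
    by (simp add: schur_coeff_def r_def s_def)
qed

text \<open>
  If the peak of a palindromic unimodal sequence lies to the right of \<open>i \<ge> d/2\<close>, then
  \<open>c (Suc i)\<close> has its mirror image \<open>c (d - Suc i)\<close> to the left of \<open>i\<close>, where the sequence
  still rises, so \<open>c (Suc i) \<le> c i\<close> nevertheless. Conversely, reflecting a decreasing upper half
  gives an increasing lower half, so the middle is a peak.
\<close>

lemma unimodal_seq_palindrome_iff:
  fixes c :: "nat \<Rightarrow> 'a::linorder"
  assumes pal: "\<And>i. i \<le> d \<Longrightarrow> c (d - i) = c i"
  shows "unimodal_seq d c \<longleftrightarrow> (\<forall>i<d. d \<le> 2 * i \<longrightarrow> c (Suc i) \<le> c i)"
proof
  assume "unimodal_seq d c"
  then obtain k where up: "\<And>i. i < k \<Longrightarrow> c i \<le> c (Suc i)"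
    and down: "\<And>i. k \<le> i \<Longrightarrow> i < d \<Longrightarrow> c (Suc i) \<le> c i"
    unfolding unimodal_seq_def by blast
  show "\<forall>i<d. d \<le> 2 * i \<longrightarrow> c (Suc i) \<le> c i"
  proof (intro allI impI)
    fix i assume i: "i < d" "d \<le> 2 * i"
    show "c (Suc i) \<le> c i"
    proof (cases "k \<le> i")
      case True
      then show ?thesis using down i by blast
    next
      case False
      have rising: "c j \<le> c m" if "j \<le> m" "m < k" for j m
        using that by (induction m rule: dec_induct) (auto intro: order_trans[OF _ up])
      have "c (d - Suc i) \<le> c i"
        using False i by (intro rising) auto
      then show ?thesis using pal[of "Suc i"] i by simp
    qed
  qed
next
  assume upper: "\<forall>i<d. d \<le> 2 * i \<longrightarrow> c (Suc i) \<le> c i"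
  have "c i \<le> c (Suc i)" if "i < d div 2" for i
  proof -
    have "c (Suc (d - Suc i)) \<le> c (d - Suc i)"
      using upper that by simp
    moreover have "Suc (d - Suc i) = d - i" using that by simp
    ultimately show ?thesis using pal[of i] pal[of "Suc i"] that by simp
  qed
  moreover have "c (Suc i) \<le> c i" if "d div 2 \<le> i" "i < d" for i
  proof (cases "d \<le> 2 * i")
    case True
    then show ?thesis using upper that by blast
  next
    \<comment> \<open>The two middle entries of a sequence with odd \<open>d\<close> are mirror images of each other.\<close>
    case False
    then have "d - i = Suc i" using that by simp
    then show ?thesis using pal[of i] that by simp
  qed
  ultimately show "unimodal_seq d c"
    unfolding unimodal_seq_def by (intro exI[of _ "d div 2"]) auto
qed

lemma unimodal_by_degree_iff_drops:
  fixes f :: "'a::{zero,linorder} poly poly"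
  assumes "symmetric2 f"
  shows "unimodal_by_degree f \<longleftrightarrow>
         (\<forall>a b. Suc b \<le> a \<longrightarrow> coeff2 f (Suc a) b \<le> coeff2 f a (Suc b))"
proof -
  have "unimodal_by_degree f \<longleftrightarrow>
      (\<forall>d. \<forall>i<d. d \<le> 2 * i \<longrightarrow> coeff2 f (Suc i) (d - Suc i) \<le> coeff2 f i (d - i))"
    unfolding unimodal_by_degree_def
    by (intro all_cong1 unimodal_seq_palindrome_iff)
      (use assms in \<open>simp add: symmetric2_def\<close>)
  also have "\<dots> \<longleftrightarrow> (\<forall>a b. Suc b \<le> a \<longrightarrow> coeff2 f (Suc a) b \<le> coeff2 f a (Suc b))"
    (is "?L \<longleftrightarrow> ?R")
  proof
    assume L: ?L
    show ?R
    proof (intro allI impI)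
      fix a b :: nat assume "Suc b \<le> a"
      then show "coeff2 f (Suc a) b \<le> coeff2 f a (Suc b)"
        using L[rule_format, of a "a + Suc b"] by simp
    qed
  next
    assume R: ?R
    show ?L
    proof (intro allI impI)
      fix d i :: nat assume "i < d" "d \<le> 2 * i"
      then show "coeff2 f (Suc i) (d - Suc i) \<le> coeff2 f i (d - i)"
        using R[rule_format, of "d - Suc i" i] by (simp add: Suc_diff_Suc)
    qed
  qed
  finally show ?thesis .
qed

lemma of_nat_diff_in_Nats_iff:
  "(of_nat m - of_nat n :: 'a::linordered_idom) \<in> \<nat> \<longleftrightarrow> n \<le> m"
proof
  assume "(of_nat m - of_nat n :: 'a) \<in> \<nat>"
  then obtain k where "(of_nat m - of_nat n :: 'a) = of_nat k" by (rule Nats_cases)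
  then have "(0::'a) \<le> of_nat m - of_nat n" by simp
  then show "n \<le> m" by simp
qed (simp flip: of_nat_diff)

theorem lemma3p1:
  fixes f :: "nat poly poly"
  assumes "symmetric2 f"
  shows "unimodal_by_degree f \<longleftrightarrow>
         (\<forall>a b. b \<le> a \<longrightarrow> schur_coeff (of_nat_poly2 f :: rat poly poly) a b \<in> \<nat>)"
proof -
  define F :: "rat poly poly" where "F = of_nat_poly2 f"
  have "symmetric2 F"
    using assms by (simp add: symmetric2_def F_def coeff2_of_nat_poly2)
  then have first: "schur_coeff F a 0 \<in> \<nat>"
    and drop: "Suc b \<le> a \<Longrightarrow>
      schur_coeff F a (Suc b) \<in> \<nat> \<longleftrightarrow> coeff2 f (Suc a) b \<le> coeff2 f a (Suc b)" for a b
    by (simp_all add: schur_coeff_eq_hw_coeff hw_coeff_def F_def coeff2_of_nat_poly2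
        of_nat_diff_in_Nats_iff)
  have "(\<forall>a b. b \<le> a \<longrightarrow> schur_coeff F a b \<in> \<nat>) \<longleftrightarrow>
      (\<forall>a b. Suc b \<le> a \<longrightarrow> coeff2 f (Suc a) b \<le> coeff2 f a (Suc b))"
    using first drop by (metis not0_implies_Suc)
  then show ?thesis
    using unimodal_by_degree_iff_drops[OF assms] by (simp add: F_def)
qed

end
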